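(* Let $3\leq g<n$ and let $G$ be a unicyclic graph on $n$ vertices with girth $g$. Then $F(G)\geq F(U_{n,g}^l)$, with equality if and only if $G$ is isomorphic to $U_{n,g}^l$. Moreover, $$F(U_{n,g}^l)=\left(\frac{n-g}{2}\right)(n+g^2+3)+g^2+1.$$
   Context: All graphs are finite, simple and undirected. A unicyclic graph is a connected graph with the same number of vertices and edges; its girth is the length of its unique cycle. The lollipop graph $U_{n,g}^l$ ($3\leq g<n$) is obtained from the cycle $C_g$ and a path on $n-g+1$ vertices by identifying one end vertex of the path with a vertex of the cycle. A connected subgraph of a graph $G=(V,E)$ is a graph $(V',E')$ with $\emptyset\neq V'\subseteq V$, $E'\subseteq E$, every edge of $E'$ having both endpoints in $V'$, and $(V',E')$ connected; distinct pairs $(V',E')$ are counted separately. The core index $F(G)$ is the number of connected subgraphs of $G$. *)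

theory Defs
  imports Complex_Main
begin

type_synonym 'a ugraph = "'a set \<times> 'a set set"

abbreviation verts :: "'a ugraph \<Rightarrow> 'a set" where
  "verts G \<equiv> fst G"

abbreviation edges :: "'a ugraph \<Rightarrow> 'a set set" where
  "edges G \<equiv> snd G"

definition simple_graph :: "'a ugraph \<Rightarrow> bool" where
  "simple_graph G \<longleftrightarrow> finite (verts G) \<and> (\<forall>e \<in> edges G. e \<subseteq> verts G \<and> card e = 2)"

definition connected_graph :: "'a ugraph \<Rightarrow> bool" where
  "connected_graph G \<longleftrightarrow> verts G \<noteq> {} \<and>
     (\<forall>u \<in> verts G. \<forall>v \<in> verts G. (u, v) \<in> {(x, y). {x, y} \<in> edges G}\<^sup>*)"

definition unicyclic :: "'a ugraph \<Rightarrow> bool" where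
  "unicyclic G \<longleftrightarrow> simple_graph G \<and> connected_graph G \<and> card (verts G) = card (edges G)"

definition cycle_edges :: "'a list \<Rightarrow> 'a set set" where
  "cycle_edges xs = {{xs ! i, xs ! (Suc i mod length xs)} | i. i < length xs}"

text \<open>A cycle of a graph is identified with its edge set, so that rotations and reversals of
  a vertex list describe the same cycle.\<close>

definition is_cycle :: "'a ugraph \<Rightarrow> 'a set set \<Rightarrow> bool" where
  "is_cycle G C \<longleftrightarrow> C \<subseteq> edges G \<and> (\<exists>xs. 3 \<le> length xs \<and> distinct xs \<and> C = cycle_edges xs)"

text \<open>The length of the unique cycle; only meaningful for graphs with exactly one cycle.\<close>

definition girth :: "'a ugraph \<Rightarrow> nat" where
  "girth G = card (THE C. is_cycle G C)"

text \<open>The cycle runs through \<open>0, \<dots>, g - 1\<close>; the path on the \<open>n - g + 1\<close> vertices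
  \<open>g - 1, \<dots>, n - 1\<close> shares its end vertex \<open>g - 1\<close> with the cycle.\<close>

definition lollipop :: "nat \<Rightarrow> nat \<Rightarrow> nat ugraph" where
  "lollipop n g = ({..<n}, cycle_edges [0..<g] \<union> {{i, Suc i} | i. g - 1 \<le> i \<and> Suc i < n})"

definition graph_iso :: "'a ugraph \<Rightarrow> 'b ugraph \<Rightarrow> bool" where
  "graph_iso G H \<longleftrightarrow> (\<exists>f. bij_betw f (verts G) (verts H) \<and>
     (\<forall>u \<in> verts G. \<forall>v \<in> verts G. {u, v} \<in> edges G \<longleftrightarrow> {f u, f v} \<in> edges H))"

definition connected_subgraphs :: "'a ugraph \<Rightarrow> 'a ugraph set" where
  "connected_subgraphs G = {H. verts H \<noteq> {} \<and> verts H \<subseteq> verts G \<and> edges H \<subseteq> edges G \<and>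
     (\<forall>e \<in> edges H. e \<subseteq> verts H) \<and> connected_graph H}"

definition core_index :: "'a ugraph \<Rightarrow> nat" where
  "core_index G = card (connected_subgraphs G)"

end

theory Submission
  imports Defs
begin

text \<open>A unicyclic graph arises from its cycle by successively attaching pendant vertices. Attaching
  \<open>v\<close> at \<open>u\<close> adds to \<open>F(G)\<close> the subgraph \<open>{v}\<close> and one subgraph for every connected subgraph
  through \<open>u\<close>, so it suffices to minimise the number \<open>F\<^sub>u(G)\<close> of connected subgraphs through a
  vertex \<open>u\<close>. If the last attached vertex is \<open>u\<close> itself, attaching it raises this number by one
  compared with its neighbour. If it is another vertex \<open>v\<close>, then \<open>F\<^sub>u\<close> grows by at least two, since
  both the whole graph and a spanning tree contain \<open>u\<close> and extend to \<open>v\<close>. Hence \<open>F\<^sub>u(G)\<close> is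
  minimal exactly when every attached vertex is joined to the previous one and \<open>u\<close> is the last,
  that is, when \<open>u\<close> is the end of a lollipop.\<close>

section \<open>Attaching a pendant vertex\<close>

abbreviation adj :: "'a set set \<Rightarrow> ('a \<times> 'a) set" where
  "adj E \<equiv> {(x, y). {x, y} \<in> E}"

definition rooted_index :: "'a ugraph \<Rightarrow> 'a \<Rightarrow> nat" where
  "rooted_index G u = card {H \<in> connected_subgraphs G. u \<in> verts H}"

definition add_pendant :: "'a \<Rightarrow> 'a \<Rightarrow> 'a ugraph \<Rightarrow> 'a ugraph" where
  "add_pendant u v G = (insert v (verts G), insert {u, v} (edges G))"

lemma sym_adj: "sym (adj E)"
  by (auto simp: sym_def insert_commute)

lemma connected_graphI_root:
  assumes "r \<in> V" and "\<And>v. v \<in> V \<Longrightarrow> (r, v) \<in> (adj E)\<^sup>*"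
  shows "connected_graph (V, E)"
proof -
  have "(x, y) \<in> (adj E)\<^sup>*" if "x \<in> V" "y \<in> V" for x y
    using assms(2)[OF that(1)] assms(2)[OF that(2)] symD[OF sym_rtrancl[OF sym_adj], of r x E]
      rtrancl_trans[of x r "adj E" y] by simp
  then show ?thesis using assms(1) by (auto simp: connected_graph_def)
qed

text \<open>A walk starting at \<open>r\<close> never leaves \<open>A\<close>. Read
  contrapositively, this yields an edge leaving any vertex set that contains \<open>r\<close> and
  misses part of the graph.\<close>

lemma connected_graph_closed_subset:
  assumes "connected_graph (V, E)" and "r \<in> A" and "r \<in> V"
    and closed: "\<And>x y. x \<in> A \<Longrightarrow> {x, y} \<in> E \<Longrightarrow> y \<in> A"
  shows "V \<subseteq> A"
proof
  fix v assume "v \<in> V"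
  with assms have "(r, v) \<in> (adj E)\<^sup>*" by (auto simp: connected_graph_def)
  then show "v \<in> A" by induction (use \<open>r \<in> A\<close> closed in auto)
qed

lemma connected_subgraphs_iff:
  "(V', E') \<in> connected_subgraphs (V, E) \<longleftrightarrow>
     V' \<subseteq> V \<and> E' \<subseteq> E \<and> \<Union>E' \<subseteq> V' \<and> connected_graph (V', E')"
  by (auto simp: connected_subgraphs_def connected_graph_def)

lemma simple_graph_add_pendant:
  assumes "simple_graph G" "u \<in> verts G" "v \<notin> verts G"
  shows "simple_graph (add_pendant u v G)"
  using assms by (auto simp: simple_graph_def add_pendant_def card_insert_if)

lemma finite_edges: "simple_graph G \<Longrightarrow> finite (edges G)"
  by (rule finite_subset[of _ "Pow (verts G)"]) (auto simp: simple_graph_def)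

lemma finite_connected_subgraphs:
  assumes "simple_graph G"
  shows "finite (connected_subgraphs G)"
proof (rule finite_subset)
  show "connected_subgraphs G \<subseteq> Pow (verts G) \<times> Pow (edges G)"
    by (auto simp: connected_subgraphs_def)
  show "finite (Pow (verts G) \<times> Pow (edges G))"
    using assms finite_edges[OF assms] by (auto simp: simple_graph_def)
qed

lemma connected_add_pendant:
  assumes "connected_graph H" "u \<in> verts H"
  shows "connected_graph (add_pendant u v H)"
  unfolding add_pendant_def
proof (rule connected_graphI_root[of u])
  fix x assume "x \<in> insert v (verts H)"
  moreover have "(u, v) \<in> (adj (insert {u, v} (edges H)))\<^sup>*" by auto
  moreover have "(u, x) \<in> (adj (insert {u, v} (edges H)))\<^sup>*" if "x \<in> verts H"
    using assms that rtrancl_mono[of "adj (edges H)" "adj (insert {u, v} (edges H))"]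
    by (auto simp: connected_graph_def)
  ultimately show "(u, x) \<in> (adj (insert {u, v} (edges H)))\<^sup>*" by auto
qed (use assms in auto)

text \<open>The retraction sending \<open>v\<close> to its only neighbour \<open>u\<close> turns
  every step of a walk at \<open>v\<close> into a standstill, so walks from \<open>u\<close> survive
  the deletion of \<open>v\<close>.\<close>

lemma connected_remove_pendant:
  assumes conn: "connected_graph (V, E)" and "V \<noteq> {v}"
    and "v \<in> V" and sub: "\<Union>E \<subseteq> V" and pendant: "\<And>x. {x, v} \<in> E \<Longrightarrow> x = u" and "u \<noteq> v"
  shows "u \<in> V" "{u, v} \<in> E" "connected_graph (V - {v}, E - {{u, v}})"
proof -
  show uv: "{u, v} \<in> E"
  proof (rule ccontr)
    assume "{u, v} \<notin> E"
    then have "V \<subseteq> {v}"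
      using pendant \<open>v \<in> V\<close>
      by (intro connected_graph_closed_subset[OF conn, of v]) (auto simp: insert_commute)
    then show False using \<open>V \<noteq> {v}\<close> \<open>v \<in> V\<close> by auto
  qed
  then show uV: "u \<in> V" using sub by auto
  let ?E = "E - {{u, v}}"
  show "connected_graph (V - {v}, ?E)"
  proof (rule connected_graphI_root[of u])
    fix x assume x: "x \<in> V - {v}"
    then have "(u, x) \<in> (adj E)\<^sup>*" using conn uV by (auto simp: connected_graph_def)
    \<comment> \<open>The endpoint is retracted in the claim because intermediate vertices of the
      walk may be \<open>v\<close>.\<close>
    then have "(u, if x = v then u else x) \<in> (adj ?E)\<^sup>*"
    proof induction
      case (step y z)
      show ?case
      proof (cases "y = v \<or> z = v")
        case True
        then have "(if z = v then u else z) = (if y = v then u else y)"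
          using step.hyps(2) pendant[of y] pendant[of z] \<open>u \<noteq> v\<close> by (auto simp: insert_commute)
        then show ?thesis using step.IH by simp
      next
        case False
        then have "(y, z) \<in> adj ?E" using step.hyps(2) by (auto simp: doubleton_eq_iff)
        then show ?thesis using step.IH False rtrancl_into_rtrancl[of u y "adj ?E" z] by simp
      qed
    qed auto
    then show "(u, x) \<in> (adj ?E)\<^sup>*" using x by simp
  qed (use uV \<open>u \<noteq> v\<close> in auto)
qed

text \<open>The edge \<open>{u, v}\<close> is the only access to \<open>v\<close>: a connected
  subgraph through \<open>v\<close> is either \<open>v\<close> alone or contains that edge, and
  deleting \<open>v\<close> then leaves a connected subgraph through \<open>u\<close>. Both
  recursions below rest on this.\<close>

lemma connected_subgraphs_add_pendant:
  assumes G: "simple_graph G" and u: "u \<in> verts G" and v: "v \<notin> verts G"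
  shows "connected_subgraphs (add_pendant u v G) =
    connected_subgraphs G \<union>
    insert ({v}, {}) (add_pendant u v ` {H \<in> connected_subgraphs G. u \<in> verts H})"
    (is "?L = ?A \<union> insert _ ?B")
proof (intro equalityI subsetI)
  obtain V E where GVE: "G = (V, E)" by force
  have E: "\<Union>E \<subseteq> V" using G GVE by (auto simp: simple_graph_def)
  have uv: "u \<noteq> v" "u \<in> V" "v \<notin> V" using u v GVE by auto
  fix H assume "H \<in> ?L"
  moreover obtain V' E' where H: "H = (V', E')" by force
  ultimately have V': "V' \<subseteq> insert v V" and E': "E' \<subseteq> insert {u, v} E" and sub: "\<Union>E' \<subseteq> V'"
    and conn: "connected_graph (V', E')"
    by (auto simp: GVE add_pendant_def connected_subgraphs_iff)
  have pendant: "x = u" if "{x, v} \<in> E'" for x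
  proof -
    have "{x, v} \<notin> E" using E uv by auto
    then show ?thesis using that E' by (auto simp: doubleton_eq_iff)
  qed
  consider "v \<notin> V'" | "V' = {v}" | "v \<in> V'" "V' \<noteq> {v}" by auto
  then show "H \<in> ?A \<union> insert ({v}, {}) ?B"
  proof cases
    case 1
    then have "V' \<subseteq> V" "E' \<subseteq> E" using V' E' sub by auto
    then show ?thesis using sub conn by (auto simp: H GVE connected_subgraphs_iff)
  next
    case 2
    have "E' = {}"
    proof (rule equals0I)
      fix e assume e: "e \<in> E'"
      then have "e \<subseteq> {v}" using sub 2 by auto
      \<comment> \<open>An edge inside \<open>{v}\<close> can lie in \<open>E\<close> only if it is
        empty; this case is excluded by cardinality.\<close>
      then have "e \<noteq> {u, v}" "e \<in> E \<longrightarrow> e = {}" using uv E by auto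
      moreover have "{} \<notin> E" using G GVE by (auto simp: simple_graph_def)
      ultimately show False using e E' by auto
    qed
    with 2 show ?thesis by (auto simp: H)
  next
    case 3
    note rem = connected_remove_pendant[OF conn 3(2,1) sub pendant uv(1)]
    have "E' - {{u, v}} \<subseteq> E" using E' by auto
    moreover from this have "\<Union>(E' - {{u, v}}) \<subseteq> V' - {v}" using E uv sub by auto
    ultimately have "(V' - {v}, E' - {{u, v}}) \<in> connected_subgraphs G"
      using rem V' by (auto simp: GVE connected_subgraphs_iff)
    moreover have "H = add_pendant u v (V' - {v}, E' - {{u, v}})"
      using rem 3 by (auto simp: H add_pendant_def)
    ultimately show ?thesis using rem uv by auto
  qed
next
  fix H assume "H \<in> ?A \<union> insert ({v}, {}) ?B"
  then show "H \<in> ?L"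
  proof (elim UnE insertE)
    assume "H \<in> ?A"
    then show ?thesis by (auto simp: connected_subgraphs_def add_pendant_def)
  next
    assume "H = ({v}, {})"
    then show ?thesis by (auto simp: connected_subgraphs_def add_pendant_def connected_graph_def)
  next
    assume "H \<in> ?B"
    then obtain H' where H': "H' \<in> connected_subgraphs G" "u \<in> verts H'" "H = add_pendant u v H'"
      by auto
    then have "connected_graph H"
      using connected_add_pendant[of H' u v] by (simp add: connected_subgraphs_def)
    then show ?thesis using H' by (auto simp: connected_subgraphs_def add_pendant_def)
  qed
qed

text \<open>\<open>H\<close> is recovered by deleting \<open>v\<close> and \<open>{u, v}\<close>,
  neither of which occurs in a subgraph of \<open>G\<close>.\<close>

lemma inj_on_add_pendant:
  assumes G: "simple_graph G" and v: "v \<notin> verts G"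
  shows "inj_on (add_pendant u v) (connected_subgraphs G)"
proof (rule inj_onI)
  fix H H' assume H: "H \<in> connected_subgraphs G" "H' \<in> connected_subgraphs G"
    and eq: "add_pendant u v H = add_pendant u v H'"
  have "v \<notin> verts H \<and> {u, v} \<notin> edges H" if "H \<in> connected_subgraphs G" for H
    using that G v by (auto simp: connected_subgraphs_def simple_graph_def subset_iff)
  with H eq show "H = H'" unfolding add_pendant_def
    by (auto simp: prod_eq_iff insert_ident)
qed

section \<open>Effect of a pendant vertex on the two indices\<close>

context
  fixes G :: "'a ugraph" and u v
  assumes G: "simple_graph G" and u: "u \<in> verts G" and v: "v \<notin> verts G"
begin

lemma pendant_notin_subgraph: "H \<in> connected_subgraphs G \<Longrightarrow> v \<notin> verts H"
  using v by (auto simp: connected_subgraphs_def)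

text \<open>The subgraphs through \<open>v\<close> are the single vertex and the extensions of the
  subgraphs through \<open>u\<close>.\<close>

lemma rooted_index_new_pendant: "rooted_index (add_pendant u v G) v = Suc (rooted_index G u)"
proof -
  let ?B = "{H \<in> connected_subgraphs G. u \<in> verts H}"
  have "{H \<in> connected_subgraphs (add_pendant u v G). v \<in> verts H} =
      insert ({v}, {}) (add_pendant u v ` ?B)"
    unfolding connected_subgraphs_add_pendant[OF G u v]
    by (auto dest: pendant_notin_subgraph simp: add_pendant_def)
  moreover have "({v}, {}) \<notin> add_pendant u v ` ?B" by (auto simp: add_pendant_def)
  moreover have "card (add_pendant u v ` ?B) = card ?B"
    by (intro card_image inj_on_subset[OF inj_on_add_pendant[OF G v]]) auto
  ultimately show ?thesis
    using finite_connected_subgraphs[OF G] by (simp add: rooted_index_def)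
qed

text \<open>The subgraphs avoiding \<open>v\<close> are those of \<open>G\<close>; the others are
  counted by \<open>rooted_index_new_pendant\<close>.\<close>

lemma core_index_add_pendant:
  "core_index (add_pendant u v G) = core_index G + Suc (rooted_index G u)"
proof -
  let ?C = "connected_subgraphs (add_pendant u v G)"
  have "?C = connected_subgraphs G \<union> {H \<in> ?C. v \<in> verts H}"
    unfolding connected_subgraphs_add_pendant[OF G u v]
    by (auto dest: pendant_notin_subgraph simp: add_pendant_def)
  moreover have "connected_subgraphs G \<inter> {H \<in> ?C. v \<in> verts H} = {}"
    by (auto dest: pendant_notin_subgraph)
  moreover have "finite ?C"
    using simple_graph_add_pendant[OF G u v] by (rule finite_connected_subgraphs)
  ultimately have "card ?C = card (connected_subgraphs G) + card {H \<in> ?C. v \<in> verts H}"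
    by (metis (no_types, lifting) card_Un_disjoint finite_Un)
  then show ?thesis
    using rooted_index_new_pendant by (simp add: core_index_def rooted_index_def)
qed

text \<open>Old subgraphs through \<open>x\<close> survive, and each spanning one in
  \<open>S\<close> contains both \<open>x\<close> and \<open>u\<close>, so it also extends to
  \<open>v\<close>. Later \<open>S\<close> consists of the whole graph and a spanning tree.\<close>

lemma rooted_index_add_pendant_ge:
  assumes x: "x \<in> verts G"
    and S: "S \<subseteq> connected_subgraphs G" "\<And>H. H \<in> S \<Longrightarrow> verts H = verts G"
  shows "rooted_index G x + card S \<le> rooted_index (add_pendant u v G) x"
proof -
  let ?C = "{H \<in> connected_subgraphs G. x \<in> verts H}"
  let ?D = "{H \<in> connected_subgraphs (add_pendant u v G). x \<in> verts H}"
  have fin: "finite ?C" "finite S" "finite ?D"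
    using finite_connected_subgraphs[OF G] S(1) finite_subset
      finite_connected_subgraphs[OF simple_graph_add_pendant[OF G u v]] by auto
  have "card ?C + card S = card ?C + card (add_pendant u v ` S)"
    using card_image[OF inj_on_subset[OF inj_on_add_pendant[OF G v] S(1)]] by simp
  also have "\<dots> = card (?C \<union> add_pendant u v ` S)"
    using fin by (subst card_Un_disjoint) (auto dest: pendant_notin_subgraph simp: add_pendant_def)
  also have "\<dots> \<le> card ?D"
  proof (rule card_mono[OF fin(3)])
    show "?C \<union> add_pendant u v ` S \<subseteq> ?D"
      unfolding connected_subgraphs_add_pendant[OF G u v]
      using x u S by (auto simp: subset_iff) (simp_all add: add_pendant_def)
  qed
  finally show ?thesis by (simp add: rooted_index_def)
qed

end

section \<open>Isomorphisms, cycles and unicyclic graphs\<close>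

text \<open>Working with images turns an isomorphic copy into an equation between graphs, which an
  induction can carry along; \<open>graph_iso\<close> enters only at the end.\<close>

definition map_graph :: "('a \<Rightarrow> 'b) \<Rightarrow> 'a ugraph \<Rightarrow> 'b ugraph" where
  "map_graph f G = (f ` verts G, (`) f ` edges G)"

lemma connected_map_graph:
  assumes "connected_graph H"
  shows "connected_graph (map_graph f H)"
proof -
  have "(f x, f y) \<in> (adj ((`) f ` edges H))\<^sup>*" if "(x, y) \<in> (adj (edges H))\<^sup>*" for x y
    using that
  proof induction
    case (step y z)
    then have "f ` {y, z} \<in> (`) f ` edges H" by blast
    then have "(f y, f z) \<in> adj ((`) f ` edges H)" by simp
    with step.IH show ?case by (rule rtrancl_into_rtrancl)
  qed auto
  then show ?thesis using assms by (auto simp: connected_graph_def map_graph_def)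
qed

lemma map_graph_in_connected_subgraphs:
  assumes "H \<in> connected_subgraphs G"
  shows "map_graph f H \<in> connected_subgraphs (map_graph f G)"
proof -
  have "connected_graph (map_graph f H)"
    using assms by (intro connected_map_graph) (auto simp: connected_subgraphs_def)
  then show ?thesis
    using assms unfolding connected_subgraphs_def map_graph_def by (auto 0 3)
qed

lemma map_graph_inv_into:
  assumes "inj_on f V" and "verts H \<subseteq> V" and "\<Union>(edges H) \<subseteq> V"
  shows "map_graph (inv_into V f) (map_graph f H) = H"
proof -
  have "inv_into V f ` f ` A = A" if "A \<subseteq> V" for A
    using inv_into_image_cancel[OF assms(1) that] .
  then have "inv_into V f ` f ` verts H = verts H"
    and "(\<lambda>e. inv_into V f ` f ` e) ` edges H = id ` edges H"
    using assms(2,3) by (blast, intro image_cong) (simp_all add: Sup_le_iff)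
  then show ?thesis by (simp add: map_graph_def image_image prod_eq_iff)
qed

lemma map_graph_inv_into_right:
  assumes "verts H \<subseteq> f ` V" and "\<Union>(edges H) \<subseteq> f ` V"
  shows "map_graph f (map_graph (inv_into V f) H) = H"
proof -
  have "f ` inv_into V f ` A = A" if "A \<subseteq> f ` V" for A
    using image_inv_into_cancel[OF refl that] .
  then have "f ` inv_into V f ` verts H = verts H"
    and "(\<lambda>e. f ` inv_into V f ` e) ` edges H = id ` edges H"
    using assms by (blast, intro image_cong) (simp_all add: Sup_le_iff)
  then show ?thesis by (simp add: map_graph_def image_image prod_eq_iff)
qed

context
  fixes f :: "'a \<Rightarrow> 'b" and G :: "'a ugraph"
  assumes inj: "inj_on f (verts G)" and G: "simple_graph G"
begin

text \<open>Images of connected subgraphs are connected subgraphs; applied to the inverse of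
  \<open>f\<close>, the same fact gives the other inclusion.\<close>

lemma connected_subgraphs_map_graph:
  "connected_subgraphs (map_graph f G) = map_graph f ` connected_subgraphs G"
proof (intro equalityI subsetI)
  fix H assume H: "H \<in> connected_subgraphs (map_graph f G)"
  let ?h = "inv_into (verts G) f"
  have "map_graph ?h H \<in> connected_subgraphs (map_graph ?h (map_graph f G))"
    using H by (rule map_graph_in_connected_subgraphs)
  also have "map_graph ?h (map_graph f G) = G"
    using G by (intro map_graph_inv_into inj) (auto simp: simple_graph_def)
  finally have "map_graph ?h H \<in> connected_subgraphs G" .
  moreover have "map_graph f (map_graph ?h H) = H"
    using H
    by (intro map_graph_inv_into_right)
      (simp_all add: connected_subgraphs_def map_graph_def Sup_le_iff, blast)
  ultimately show "H \<in> map_graph f ` connected_subgraphs G" by force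
qed (auto intro: map_graph_in_connected_subgraphs)

lemma inj_on_map_graph: "inj_on (map_graph f) (connected_subgraphs G)"
proof (rule inj_on_inverseI)
  fix H assume "H \<in> connected_subgraphs G"
  then show "map_graph (inv_into (verts G) f) (map_graph f H) = H"
    by (intro map_graph_inv_into inj) (auto simp: connected_subgraphs_def)
qed

lemma core_index_map_graph: "core_index (map_graph f G) = core_index G"
  by (simp add: core_index_def connected_subgraphs_map_graph card_image inj_on_map_graph)

lemma rooted_index_map_graph:
  assumes "u \<in> verts G"
  shows "rooted_index (map_graph f G) (f u) = rooted_index G u"
proof -
  have "f u \<in> verts (map_graph f H) \<longleftrightarrow> u \<in> verts H" if "H \<in> connected_subgraphs G" for H
    using that assms inj_on_image_mem_iff[OF inj, of u "verts H"]
    by (simp add: connected_subgraphs_def map_graph_def)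
  then have "{H \<in> connected_subgraphs (map_graph f G). f u \<in> verts H} =
      map_graph f ` {H \<in> connected_subgraphs G. u \<in> verts H}"
    unfolding connected_subgraphs_map_graph by blast
  moreover have "inj_on (map_graph f) {H \<in> connected_subgraphs G. u \<in> verts H}"
    by (rule inj_on_subset[OF inj_on_map_graph]) auto
  ultimately show ?thesis by (simp add: rooted_index_def card_image)
qed

text \<open>The inverse of \<open>f\<close> on \<open>verts G\<close> is the isomorphism. With the
  lollipop as \<open>G\<close>, this concludes the equality case.\<close>

lemma graph_iso_map_graph: "graph_iso (map_graph f G) G"
  unfolding graph_iso_def
proof (intro exI conjI ballI)
  let ?h = "inv_into (verts G) f"
  show "bij_betw ?h (verts (map_graph f G)) (verts G)"
    using inj by (simp add: map_graph_def bij_betw_inv_into inj_on_imp_bij_betw)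
  fix x y assume "x \<in> verts (map_graph f G)" "y \<in> verts (map_graph f G)"
  then obtain a b where ab: "a \<in> verts G" "b \<in> verts G" "x = f a" "y = f b"
    by (auto simp: map_graph_def)
  have "f ` {a, b} \<in> (`) f ` edges G \<longleftrightarrow> {a, b} \<in> edges G"
  proof (rule inj_on_image_mem_iff)
    show "inj_on ((`) f) (Pow (verts G))" using inj by (rule inj_on_image_Pow)
  qed (use G ab in \<open>auto simp: simple_graph_def\<close>)
  then show "{x, y} \<in> edges (map_graph f G) \<longleftrightarrow> {?h x, ?h y} \<in> edges G"
    using ab inj by (simp add: map_graph_def)
qed

end

text \<open>Adjacency of vertex pairs determines a simple graph, since every edge is a pair; so the
  bijection in \<open>graph_iso\<close> exhibits \<open>H\<close> as the image
  \<open>map_graph f G\<close>.\<close>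

lemma graph_iso_core_index:
  assumes iso: "graph_iso G H" and G: "simple_graph G" and H: "simple_graph H"
  shows "core_index G = core_index H"
proof -
  obtain f where bij: "bij_betw f (verts G) (verts H)"
    and adj: "\<And>u v. u \<in> verts G \<Longrightarrow> v \<in> verts G \<Longrightarrow> {u, v} \<in> edges G \<longleftrightarrow> {f u, f v} \<in> edges H"
    using iso by (auto simp: graph_iso_def)
  have "(`) f ` edges G = edges H"
  proof (intro equalityI subsetI)
    fix e assume "e \<in> (`) f ` edges G"
    then obtain d where d: "d \<in> edges G" "e = f ` d" by auto
    then obtain a b where "d = {a, b}" using G by (auto simp: simple_graph_def card_2_iff)
    with d show "e \<in> edges H" using adj[of a b] G by (auto simp: simple_graph_def)
  next
    fix e assume e: "e \<in> edges H"
    then obtain x y where "e = {x, y}" using H by (auto simp: simple_graph_def card_2_iff)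
    moreover from this obtain a b where ab: "a \<in> verts G" "b \<in> verts G" "x = f a" "y = f b"
    proof -
      have "e \<subseteq> f ` verts G" using H e bij by (simp add: simple_graph_def bij_betw_def)
      then show thesis using that \<open>e = {x, y}\<close> by auto
    qed
    ultimately have "{a, b} \<in> edges G" "e = f ` {a, b}" using adj e by auto
    then show "e \<in> (`) f ` edges G" by blast
  qed
  then have "H = map_graph f G" using bij by (auto simp: map_graph_def bij_betw_def prod_eq_iff)
  then show ?thesis using core_index_map_graph[OF bij_betw_imp_inj_on[OF bij] G] by simp
qed

section \<open>Cycle graphs\<close>

definition cycle_graph :: "'a list \<Rightarrow> 'a ugraph" where
  "cycle_graph xs = (set xs, cycle_edges xs)"

lemma cycle_edges_image:
  "cycle_edges xs = (\<lambda>i. {xs ! i, xs ! (Suc i mod length xs)}) ` {..<length xs}"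
  by (auto simp: cycle_edges_def)

lemma Suc_mod_eq: "i < n \<Longrightarrow> Suc i mod n = (if Suc i = n then 0 else Suc i)"
  by (auto simp: mod_less)

text \<open>Two distinct indices with the same edge would be successors of each other modulo the
  length, which forces length two.\<close>

lemma inj_on_cycle_edge:
  assumes "distinct xs" "3 \<le> length xs"
  shows "inj_on (\<lambda>i. {xs ! i, xs ! (Suc i mod length xs)}) {..<length xs}"
proof (rule inj_onI, goal_cases)
  case (1 i j)
  moreover have "Suc i mod length xs < length xs" "Suc j mod length xs < length xs"
    using assms(2) by (auto intro!: mod_less_divisor)
  ultimately have "{i, Suc i mod length xs} = {j, Suc j mod length xs}"
    using assms(1) by (auto simp: doubleton_eq_iff nth_eq_iff_index_eq)
  with 1 assms(2) show ?case by (auto simp: Suc_mod_eq doubleton_eq_iff split: if_splits)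
qed

lemma card_cycle_edges:
  assumes "distinct xs" "3 \<le> length xs"
  shows "card (cycle_edges xs) = length xs"
  unfolding cycle_edges_image using card_image[OF inj_on_cycle_edge[OF assms]] by simp

lemma simple_cycle_graph:
  assumes "distinct xs" "3 \<le> length xs"
  shows "simple_graph (cycle_graph xs)"
proof -
  have "xs ! i \<noteq> xs ! (Suc i mod length xs)" if "i < length xs" for i
  proof -
    have "Suc i mod length xs < length xs" "i \<noteq> Suc i mod length xs"
      using assms that by (auto simp: Suc_mod_eq)
    then show ?thesis using assms that by (simp add: nth_eq_iff_index_eq)
  qed
  then show ?thesis
    by (auto simp: simple_graph_def cycle_graph_def cycle_edges_def card_insert_if
        intro!: nth_mem mod_less_divisor)
qed

lemma connected_cycle_graph:
  assumes "xs \<noteq> []"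
  shows "connected_graph (cycle_graph xs)"
  unfolding cycle_graph_def
proof (rule connected_graphI_root[of "xs ! 0"])
  have "(xs ! 0, xs ! i) \<in> (adj (cycle_edges xs))\<^sup>*" if "i < length xs" for i
    using that
  proof (induction i)
    case (Suc i)
    then have "{xs ! i, xs ! (Suc i mod length xs)} \<in> cycle_edges xs"
      unfolding cycle_edges_image by (intro imageI) auto
    then have "(xs ! i, xs ! Suc i) \<in> adj (cycle_edges xs)" using Suc by simp
    then show ?case using Suc by (auto intro: rtrancl_into_rtrancl)
  qed auto
  then show "(xs ! 0, v) \<in> (adj (cycle_edges xs))\<^sup>*" if "v \<in> set xs" for v
    using that by (metis in_set_conv_nth)
qed (use assms in auto)

lemma unicyclic_cycle_graph:
  assumes "distinct xs" "3 \<le> length xs"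
  shows "unicyclic (cycle_graph xs)"
proof -
  have "connected_graph (cycle_graph xs)" using assms by (intro connected_cycle_graph) auto
  then show ?thesis
    using simple_cycle_graph[OF assms] card_cycle_edges[OF assms] distinct_card[OF assms(1)]
    by (simp add: unicyclic_def cycle_graph_def)
qed

lemma cycle_edges_map: "cycle_edges (map f xs) = (`) f ` cycle_edges xs"
proof -
  have "{map f xs ! i, map f xs ! (Suc i mod length xs)} = f ` {xs ! i, xs ! (Suc i mod length xs)}"
    if "i < length xs" for i
  proof -
    have "Suc i mod length xs < length xs" using that by (intro mod_less_divisor) auto
    then show ?thesis using that by simp
  qed
  then show ?thesis unfolding cycle_edges_image image_image by (auto intro!: image_cong)
qed

text \<open>The list, read as a function of its index, is the vertex map. Any cycle thus becomes an
  image of the standard one, from which the lollipop is built.\<close>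

lemma cycle_graph_eq_map_graph:
  "cycle_graph xs = map_graph ((!) xs) (cycle_graph [0..<length xs])"
  using cycle_edges_map[of "(!) xs" "[0..<length xs]"] set_map[of "(!) xs" "[0..<length xs]"]
  unfolding map_nth by (simp add: map_graph_def cycle_graph_def)

text \<open>Passing to the successor modulo the length permutes the indices, so it only reindexes
  the edges.\<close>

lemma cycle_edges_rotate1: "cycle_edges (rotate1 xs) = cycle_edges xs"
proof -
  let ?n = "length xs"
  have "(\<lambda>i. Suc i mod ?n) ` {..<?n} = {..<?n}"
  proof (rule card_subset_eq)
    have "inj_on (\<lambda>i. Suc i mod ?n) {..<?n}"
      by (auto simp: inj_on_def Suc_mod_eq split: if_splits)
    then show "card ((\<lambda>i. Suc i mod ?n) ` {..<?n}) = card {..<?n}" by (rule card_image)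
  qed (auto intro: mod_less_divisor)
  then have "cycle_edges xs =
      (\<lambda>i. {xs ! i, xs ! (Suc i mod ?n)}) ` (\<lambda>i. Suc i mod ?n) ` {..<?n}"
    by (simp add: cycle_edges_image)
  also have "\<dots> = (\<lambda>i. {rotate1 xs ! i, rotate1 xs ! (Suc i mod ?n)}) ` {..<?n}"
    unfolding image_image
  proof (intro image_cong refl, goal_cases)
    case (1 i)
    then have "Suc i mod ?n < ?n" by (intro mod_less_divisor) auto
    then show ?case using 1 by (simp add: nth_rotate1)
  qed
  finally show ?thesis by (simp add: cycle_edges_image)
qed

lemma cycle_graph_rotate: "cycle_graph (rotate k xs) = cycle_graph xs"
proof -
  have "cycle_edges (rotate k xs) = cycle_edges xs"
    by (induction k) (simp_all add: cycle_edges_rotate1)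
  then show ?thesis by (simp add: cycle_graph_def)
qed

text \<open>The predecessor and the successor of \<open>v\<close> differ since there are at least
  three vertices. Hence a vertex of a cycle is never pendant, which drives the uniqueness of the
  cycle.\<close>

lemma cycle_vertex_two_neighbours:
  assumes "distinct xs" "3 \<le> length xs" "v \<in> set xs"
  obtains a b where "a \<noteq> b" "{a, v} \<in> cycle_edges xs" "{b, v} \<in> cycle_edges xs"
proof -
  let ?n = "length xs"
  obtain i where i: "i < ?n" "v = xs ! i" using assms(3) by (auto simp: in_set_conv_nth)
  define p where "p = (if i = 0 then ?n - 1 else i - 1)"
  have p: "p < ?n" "Suc p mod ?n = i" using assms(2) i by (auto simp: p_def Suc_mod_eq)
  have s: "Suc i mod ?n < ?n" "Suc i mod ?n \<noteq> p"
    using assms(2) i by (auto simp: p_def Suc_mod_eq)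
  have "{xs ! p, v} \<in> cycle_edges xs" using p i by (auto simp: cycle_edges_def)
  moreover have "{xs ! (Suc i mod ?n), v} \<in> cycle_edges xs"
    using i by (auto simp: cycle_edges_def insert_commute)
  moreover have "xs ! (Suc i mod ?n) \<noteq> xs ! p"
    using s p assms(1) by (simp add: nth_eq_iff_index_eq)
  ultimately show ?thesis using that by blast
qed

section \<open>Graphs grown by pendant vertices\<close>

lemma add_pendant_neighbour:
  assumes "simple_graph G" "v \<notin> verts G" "{x, v} \<in> edges (add_pendant u v G)"
  shows "x = u"
  using assms by (auto simp: add_pendant_def simple_graph_def doubleton_eq_iff)

text \<open>One relation serves both kinds of graph needed: from a single vertex it generates trees,
  from a cycle the unicyclic graphs containing it.\<close>

inductive pendant_ext :: "'a ugraph \<Rightarrow> 'a ugraph \<Rightarrow> bool" for G\<^sub>0 where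
  base: "pendant_ext G\<^sub>0 G\<^sub>0"
| step: "pendant_ext G\<^sub>0 G \<Longrightarrow> u \<in> verts G \<Longrightarrow> v \<notin> verts G \<Longrightarrow> pendant_ext G\<^sub>0 (add_pendant u v G)"

lemma pendant_ext_simple: "pendant_ext G\<^sub>0 G \<Longrightarrow> simple_graph G\<^sub>0 \<Longrightarrow> simple_graph G"
  by (induction rule: pendant_ext.induct) (auto intro: simple_graph_add_pendant)

lemma pendant_ext_connected: "pendant_ext G\<^sub>0 G \<Longrightarrow> connected_graph G\<^sub>0 \<Longrightarrow> connected_graph G"
  by (induction rule: pendant_ext.induct) (auto intro: connected_add_pendant)

lemma card_verts_add_pendant:
  assumes "simple_graph G" "v \<notin> verts G"
  shows "card (verts (add_pendant u v G)) = Suc (card (verts G))"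
  using assms by (simp add: simple_graph_def add_pendant_def)

lemma card_edges_add_pendant:
  assumes "simple_graph G" "v \<notin> verts G"
  shows "card (edges (add_pendant u v G)) = Suc (card (edges G))"
proof -
  have "{u, v} \<notin> edges G" using assms by (auto simp: simple_graph_def)
  then show ?thesis using finite_edges[OF assms(1)] by (simp add: add_pendant_def)
qed

text \<open>Each step adds one vertex and one edge, so the difference of the two numbers is
  invariant; the sums avoid subtraction on \<open>nat\<close>.\<close>

lemma pendant_ext_card:
  assumes "pendant_ext G\<^sub>0 G" "simple_graph G\<^sub>0"
  shows "card (verts G) + card (edges G\<^sub>0) = card (edges G) + card (verts G\<^sub>0)"
  using assms
  by (induction rule: pendant_ext.induct)
    (auto dest: pendant_ext_simple simp: card_verts_add_pendant card_edges_add_pendant)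

text \<open>While vertices of \<open>G\<close> are missing, connectedness gives an edge leaving the
  part reached so far, and its outer end is attached as a pendant vertex.\<close>

lemma spanning_pendant_ext:
  assumes G: "simple_graph G" "connected_graph G"
    and G\<^sub>0: "verts G\<^sub>0 \<noteq> {}" "verts G\<^sub>0 \<subseteq> verts G" "edges G\<^sub>0 \<subseteq> edges G"
  obtains H where "pendant_ext G\<^sub>0 H" "verts H = verts G" "edges H \<subseteq> edges G"
proof -
  \<comment> \<open>For the induction the claim speaks of any intermediate stage \<open>H\<close>;
    the measure is the number of vertices still missing.\<close>
  have "\<exists>H'. pendant_ext G\<^sub>0 H' \<and> verts H' = verts G \<and> edges H' \<subseteq> edges G"
    if "pendant_ext G\<^sub>0 H" "verts H \<noteq> {}" "verts H \<subseteq> verts G" "edges H \<subseteq> edges G" for H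
    using that
  proof (induction "card (verts G - verts H)" arbitrary: H rule: less_induct)
    case less
    show ?case
    proof (cases "verts H = verts G")
      case True
      with less.prems show ?thesis by blast
    next
      case False
      obtain r where r: "r \<in> verts H" using less.prems by auto
      have "\<exists>x y. x \<in> verts H \<and> {x, y} \<in> edges G \<and> y \<notin> verts H"
      proof (rule ccontr)
        assume "\<not> ?thesis"
        then have "verts G \<subseteq> verts H"
          using G(2) r less.prems(3)
          by (intro connected_graph_closed_subset[of "verts G" "edges G" r "verts H"]) auto
        then show False using False less.prems(3) by blast
      qed
      then obtain x y where xy: "x \<in> verts H" "{x, y} \<in> edges G" "y \<notin> verts H" by blast
      have y: "y \<in> verts G" using xy G by (auto simp: simple_graph_def)
      have "card (verts G - insert y (verts H)) < card (verts G - verts H)"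
        using y xy G(1) by (intro psubset_card_mono) (auto simp: simple_graph_def)
      then show ?thesis
        using less.prems xy y pendant_ext.step[OF less.prems(1) xy(1,3)]
        by (intro less.hyps[of "add_pendant x y H"]) (auto simp: add_pendant_def)
    qed
  qed
  from this[OF pendant_ext.base G\<^sub>0] show ?thesis using that by blast
qed

lemma spanning_tree:
  assumes "simple_graph G" "connected_graph G"
  obtains T where "connected_graph T" "verts T = verts G" "edges T \<subseteq> edges G"
    "Suc (card (edges T)) = card (verts G)"
proof -
  obtain r where r: "r \<in> verts G" using assms by (auto simp: connected_graph_def)
  obtain T where T: "pendant_ext ({r}, {}) T" "verts T = verts G" "edges T \<subseteq> edges G"
    using spanning_pendant_ext[OF assms, of "({r}, {})"] r by auto
  have "simple_graph ({r}, {})" "connected_graph ({r}, {})"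
    by (auto simp: simple_graph_def connected_graph_def)
  with T pendant_ext_card[OF T(1)] pendant_ext_connected[OF T(1)] show ?thesis
    using that by simp
qed

section \<open>Existence and uniqueness of the cycle\<close>

lemma rtrancl_adj_path:
  assumes "(a, b) \<in> (adj E)\<^sup>*"
  obtains xs where "xs \<noteq> []" "distinct xs" "hd xs = a" "last xs = b"
    "successively (\<lambda>x y. {x, y} \<in> E) xs"
proof -
  have "\<exists>xs. xs \<noteq> [] \<and> distinct xs \<and> hd xs = a \<and> last xs = b \<and>
      successively (\<lambda>x y. {x, y} \<in> E) xs"
    using assms
  proof induction
    case base
    show ?case by (rule exI[of _ "[a]"]) auto
  next
    case (step y z)
    then obtain xs where xs: "xs \<noteq> []" "distinct xs" "hd xs = a" "last xs = y"
      "successively (\<lambda>x y. {x, y} \<in> E) xs" by blast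
    show ?case
    proof (cases "z \<in> set xs")
      \<comment> \<open>The walk returns to the path, which is cut back to the earlier occurrence of
        \<open>z\<close>.\<close>
      case True
      then obtain us ws where "xs = us @ z # ws" by (auto simp: in_set_conv_decomp)
      with xs show ?thesis
        by (intro exI[of _ "us @ [z]"]) (auto simp: successively_append_iff hd_append)
    next
      case False
      with xs step.hyps show ?thesis
        by (intro exI[of _ "xs @ [z]"]) (auto simp: successively_append_iff)
    qed
  qed
  then show ?thesis using that by blast
qed

text \<open>A spanning tree has one edge fewer than \<open>G\<close>. The path in the tree between
  the ends of the left-over edge, closed by that edge, is a cycle.\<close>

lemma unicyclic_has_cycle:
  assumes "unicyclic G"
  obtains xs where "distinct xs" "3 \<le> length xs" "cycle_edges xs \<subseteq> edges G"
proof -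
  have G: "simple_graph G" "connected_graph G" "card (verts G) = card (edges G)"
    using assms by (auto simp: unicyclic_def)
  obtain T where T: "connected_graph T" "verts T = verts G" "edges T \<subseteq> edges G"
    "Suc (card (edges T)) = card (verts G)"
    using spanning_tree[OF G(1,2)] by blast
  then have "edges T \<noteq> edges G" using G(3) by auto
  then obtain e where e: "e \<in> edges G" "e \<notin> edges T" using T(3) by auto
  moreover obtain a b where ab: "e = {a, b}" "a \<noteq> b"
    using G(1) e by (auto simp: simple_graph_def card_2_iff)
  ultimately have "a \<in> verts T" "b \<in> verts T" using G(1) T(2) by (auto simp: simple_graph_def)
  then have "(a, b) \<in> (adj (edges T))\<^sup>*" using T(1) by (auto simp: connected_graph_def)
  then obtain xs where xs: "xs \<noteq> []" "distinct xs" "hd xs = a" "last xs = b"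
    "successively (\<lambda>x y. {x, y} \<in> edges T) xs"
    using rtrancl_adj_path by metis
  \<comment> \<open>Length one would give \<open>a = b\<close>, and length two would put
    \<open>e\<close> into the tree.\<close>
  have "length xs \<noteq> 0" "length xs \<noteq> 1" "length xs \<noteq> 2"
    using xs e ab by (auto simp: length_Suc_conv numeral_2_eq_2)
  then have "3 \<le> length xs" by linarith
  moreover have "{xs ! i, xs ! (Suc i mod length xs)} \<in> edges G" if "i < length xs" for i
  proof (cases "Suc i = length xs")
    case True
    then have "xs ! i = b" using xs by (metis diff_Suc_1 last_conv_nth)
    then show ?thesis using True xs e ab by (simp add: hd_conv_nth[symmetric] insert_commute)
  next
    case False
    then show ?thesis using that xs(5) T(3) by (auto simp: successively_conv_nth)
  qed
  then have "cycle_edges xs \<subseteq> edges G" by (auto simp: cycle_edges_def)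
  ultimately show ?thesis using xs(2) that by blast
qed

text \<open>Growing the cycle to a spanning subgraph keeps the numbers of vertices and edges equal,
  so no edge of \<open>G\<close> is left over.\<close>

lemma unicyclic_pendant_ext:
  assumes "unicyclic G" and xs: "distinct xs" "3 \<le> length xs" and sub: "cycle_edges xs \<subseteq> edges G"
  shows "pendant_ext (cycle_graph xs) G"
proof -
  have G: "simple_graph G" "connected_graph G" "card (verts G) = card (edges G)"
    using assms by (auto simp: unicyclic_def)
  have "v \<in> verts G" if v: "v \<in> set xs" for v
  proof -
    obtain a where "{a, v} \<in> cycle_edges xs"
      using cycle_vertex_two_neighbours[OF xs v] by metis
    then have "{a, v} \<subseteq> verts G" using sub G(1) unfolding simple_graph_def by blast
    then show ?thesis by simp
  qed
  then have "verts (cycle_graph xs) \<noteq> {}" "verts (cycle_graph xs) \<subseteq> verts G"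
    "edges (cycle_graph xs) \<subseteq> edges G"
    using xs sub by (auto simp: cycle_graph_def)
  then obtain H where H: "pendant_ext (cycle_graph xs) H" "verts H = verts G"
    "edges H \<subseteq> edges G"
    using spanning_pendant_ext[OF G(1,2)] by metis
  have "card (verts H) = card (edges H)"
    using pendant_ext_card[OF H(1) simple_cycle_graph[OF xs]] unicyclic_cycle_graph[OF xs]
    by (simp add: unicyclic_def)
  then have "edges H = edges G"
    using H G finite_edges[OF G(1)] by (intro card_subset_eq) auto
  then show ?thesis using H by (metis prod.collapse)
qed

text \<open>The vertex attached last has a single neighbour, so no cycle passes through it or uses
  its edge.\<close>

lemma cycle_in_pendant_ext:
  assumes "pendant_ext G\<^sub>0 G" "simple_graph G\<^sub>0"
    and "distinct xs" "3 \<le> length xs" "cycle_edges xs \<subseteq> edges G"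
  shows "cycle_edges xs \<subseteq> edges G\<^sub>0"
  using assms
proof (induction rule: pendant_ext.induct)
  case (step G u v)
  have G: "simple_graph G" using step pendant_ext_simple by blast
  have "v \<notin> set xs"
  proof
    assume "v \<in> set xs"
    then obtain a b where "a \<noteq> b" "{a, v} \<in> cycle_edges xs" "{b, v} \<in> cycle_edges xs"
      using cycle_vertex_two_neighbours step.prems by metis
    then show False using add_pendant_neighbour[OF G step.hyps(3)] step.prems by blast
  qed
  moreover have "\<Union>(cycle_edges xs) \<subseteq> set xs"
    by (auto simp: cycle_edges_def intro!: nth_mem mod_less_divisor)
  ultimately have "{u, v} \<notin> cycle_edges xs" by auto
  then show ?case using step by (auto simp: add_pendant_def)
qed auto

text \<open>A cycle inside a cycle graph extends to the whole graph by pendant vertices;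
  as no vertex of a cycle graph is pendant, no extension takes place.\<close>

lemma cycle_graph_unique_cycle:
  assumes xs: "distinct xs" "3 \<le> length xs" and ys: "distinct ys" "3 \<le> length ys"
    and sub: "cycle_edges ys \<subseteq> cycle_edges xs"
  shows "cycle_edges ys = cycle_edges xs"
proof -
  have "pendant_ext (cycle_graph ys) (cycle_graph xs)"
    using unicyclic_pendant_ext[OF unicyclic_cycle_graph[OF xs] ys] sub
    by (simp add: cycle_graph_def)
  then show ?thesis
  proof cases
    case base
    then show ?thesis by (simp add: cycle_graph_def)
  next
    case (step G u v)
    have G: "simple_graph G" using step pendant_ext_simple simple_cycle_graph[OF ys] by blast
    have "v \<in> set xs" using step(1) by (auto simp: cycle_graph_def add_pendant_def)
    then obtain a b where "a \<noteq> b" "{a, v} \<in> cycle_edges xs" "{b, v} \<in> cycle_edges xs"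
      using cycle_vertex_two_neighbours[OF xs] by metis
    moreover have "cycle_edges xs = edges (add_pendant u v G)"
      using step(1) by (simp add: cycle_graph_def prod_eq_iff)
    ultimately show ?thesis using add_pendant_neighbour[OF G step(4)] by metis
  qed
qed

text \<open>Every cycle of \<open>G\<close> lies in the initial cycle graph and hence coincides with
  it, so the definite description in \<open>girth\<close> denotes \<open>cycle_edges xs\<close>,
  which has \<open>length xs\<close> elements.\<close>

lemma unicyclic_girth:
  assumes G: "unicyclic G"
  obtains xs where "distinct xs" "3 \<le> length xs" "length xs = girth G"
    "pendant_ext (cycle_graph xs) G"
proof -
  obtain xs where xs: "distinct xs" "3 \<le> length xs" and sub: "cycle_edges xs \<subseteq> edges G"
    using unicyclic_has_cycle[OF G] by blast
  have ext: "pendant_ext (cycle_graph xs) G" using unicyclic_pendant_ext[OF G xs sub] .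
  have "C = cycle_edges xs" if "is_cycle G C" for C
  proof -
    obtain ys where ys: "distinct ys" "3 \<le> length ys" "C = cycle_edges ys" "C \<subseteq> edges G"
      using \<open>is_cycle G C\<close> by (auto simp: is_cycle_def)
    then have "C \<subseteq> cycle_edges xs"
      using cycle_in_pendant_ext[OF ext simple_cycle_graph[OF xs] ys(1,2)]
      by (simp add: cycle_graph_def)
    then show ?thesis using cycle_graph_unique_cycle[OF xs ys(1,2)] ys(3) by simp
  qed
  moreover have "is_cycle G (cycle_edges xs)" using xs sub by (auto simp: is_cycle_def)
  ultimately have "(THE C. is_cycle G C) = cycle_edges xs" by (intro the_equality)
  then have "length xs = girth G" using card_cycle_edges[OF xs] by (simp add: girth_def)
  then show ?thesis using that xs ext by blast
qed

section \<open>The lollipop minimises the core index\<close>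

text \<open>The lollipop without a tail is the base of every induction on \<open>n\<close>.\<close>

lemma lollipop_self: "1 \<le> g \<Longrightarrow> lollipop g g = cycle_graph [0..<g]"
  by (auto simp: lollipop_def cycle_graph_def)

text \<open>The tail grows at its tip \<open>n - 1\<close>; for \<open>n = g\<close> this is the
  vertex of the cycle where the tail starts.\<close>

lemma lollipop_Suc:
  assumes "1 \<le> g" "g \<le> n"
  shows "lollipop (Suc n) g = add_pendant (n - 1) n (lollipop n g)"
proof -
  have "{{i, Suc i} | i. g - 1 \<le> i \<and> Suc i < Suc n} =
      insert {n - 1, n} {{i, Suc i} | i. g - 1 \<le> i \<and> Suc i < n}" (is "?L = insert ?e ?R")
  proof (intro equalityI subsetI)
    fix e assume "e \<in> ?L"
    then obtain i where "e = {i, Suc i}" "g - 1 \<le> i" "i < n" by auto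
    then show "e \<in> insert ?e ?R" by (cases "Suc i = n") auto
  next
    have "?e = {n - 1, Suc (n - 1)}" "g - 1 \<le> n - 1" "Suc (n - 1) < Suc n" using assms by auto
    then have "?e \<in> ?L" by blast
    moreover have "?R \<subseteq> ?L" by auto
    ultimately show "e \<in> ?L" if "e \<in> insert ?e ?R" for e using that by blast
  qed
  then show ?thesis by (simp add: lollipop_def add_pendant_def lessThan_Suc)
qed

lemma verts_lollipop [simp]: "verts (lollipop n g) = {..<n}"
  by (simp add: lollipop_def)

lemma simple_lollipop:
  assumes "3 \<le> g" "g \<le> n"
  shows "simple_graph (lollipop n g)"
  using assms(2)
proof (induction n rule: dec_induct)
  case base
  show ?case using assms simple_cycle_graph[of "[0..<g]"] by (simp add: lollipop_self)
next
  case (step n)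
  then show ?case
    using assms by (auto simp: lollipop_Suc intro!: simple_graph_add_pendant)
qed

context
  fixes n g :: nat
  assumes g: "3 \<le> g" "g \<le> n"
begin

lemma rooted_index_lollipop_Suc:
  "rooted_index (lollipop (Suc n) g) n = Suc (rooted_index (lollipop n g) (n - 1))"
  using g rooted_index_new_pendant[OF simple_lollipop[OF g], of "n - 1" n]
  by (simp add: lollipop_Suc)

lemma core_index_lollipop_Suc:
  "core_index (lollipop (Suc n) g) =
     core_index (lollipop n g) + Suc (rooted_index (lollipop n g) (n - 1))"
  using g core_index_add_pendant[OF simple_lollipop[OF g], of "n - 1" n]
  by (simp add: lollipop_Suc)

text \<open>Requiring \<open>f\<close> to send the tip \<open>n - 1\<close> to \<open>u\<close> is
  what lets it extend, as the new edge \<open>{n - 1, n}\<close> then goes to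
  \<open>{u, v}\<close>.\<close>

lemma map_graph_lollipop_Suc:
  assumes f: "inj_on f {..<n}" "map_graph f (lollipop n g) = G" "f (n - 1) = u"
    and v: "v \<notin> verts G"
  shows "inj_on (f(n := v)) {..<Suc n}"
    "map_graph (f(n := v)) (lollipop (Suc n) g) = add_pendant u v G"
proof -
  let ?f = "f(n := v)"
  have verts: "f ` {..<n} = verts G" using f(2) by (auto simp: map_graph_def)
  then show "inj_on ?f {..<Suc n}"
    using f(1) v by (auto simp: lessThan_Suc inj_on_def)
  have img: "?f ` A = f ` A" if "A \<subseteq> {..<n}" for A
    using that by (intro image_cong) auto
  have "(`) ?f ` edges (lollipop n g) = (`) f ` edges (lollipop n g)"
    using simple_lollipop[OF g] by (intro image_cong img) (auto simp: simple_graph_def)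
  moreover have "n - 1 \<noteq> n" using g by simp
  ultimately show "map_graph ?f (lollipop (Suc n) g) = add_pendant u v G"
    using f g img[of "{..<n}"]
    by (auto simp: lollipop_Suc map_graph_def add_pendant_def prod_eq_iff)
qed

end

text \<open>All vertices of a cycle are alike: a rotation of the list moves \<open>u\<close> to the
  last place, which is the root of the tailless lollipop.\<close>

lemma cycle_graph_rooted_lollipop:
  assumes xs: "distinct xs" "3 \<le> length xs" and u: "u \<in> set xs"
  obtains f where "inj_on f {..<length xs}"
    "map_graph f (lollipop (length xs) (length xs)) = cycle_graph xs" "f (length xs - 1) = u"
proof -
  let ?n = "length xs"
  obtain k where k: "k < ?n" "xs ! k = u" using u by (auto simp: in_set_conv_nth)
  \<comment> \<open>Rotating by \<open>Suc k\<close> moves the entry with index \<open>k\<close> to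
    the end of the list.\<close>
  define ys where "ys = rotate (Suc k) xs"
  have "ys ! (?n - 1) = xs ! ((Suc k + (?n - 1)) mod ?n)"
    unfolding ys_def using k by (intro nth_rotate) auto
  also have "Suc k + (?n - 1) = k + ?n" using k by simp
  finally have "ys ! (?n - 1) = u" using k by simp
  moreover have "distinct ys" "length ys = ?n" using xs by (simp_all add: ys_def)
  moreover from this have "inj_on ((!) ys) {..<?n}" by (auto simp: inj_on_def nth_eq_iff_index_eq)
  moreover have "map_graph ((!) ys) (lollipop ?n ?n) = cycle_graph ys"
    using \<open>length ys = ?n\<close> xs(2) cycle_graph_eq_map_graph[of ys] lollipop_self[of ?n] by simp
  moreover have "cycle_graph ys = cycle_graph xs" by (simp only: ys_def cycle_graph_rotate)
  ultimately show ?thesis using that by simp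
qed

section \<open>Lower bounds with their equality cases\<close>

context
  fixes xs :: "'a list" and g
  assumes xs: "distinct xs" "3 \<le> length xs" and g: "g = length xs"
begin

lemma pendant_ext_cycle_graph:
  assumes "pendant_ext (cycle_graph xs) G"
  shows "simple_graph G" "connected_graph G" "card (verts G) = card (edges G)"
    "g \<le> card (verts G)"
proof -
  show G: "simple_graph G"
    using pendant_ext_simple[OF assms simple_cycle_graph[OF xs]] .
  show "connected_graph G"
    using pendant_ext_connected[OF assms] unicyclic_cycle_graph[OF xs] by (simp add: unicyclic_def)
  show "card (verts G) = card (edges G)"
    using pendant_ext_card[OF assms simple_cycle_graph[OF xs]] unicyclic_cycle_graph[OF xs]
    by (simp add: unicyclic_def)
  have "set xs \<subseteq> verts G" using assms
    by (induction rule: pendant_ext.induct) (auto simp: cycle_graph_def add_pendant_def)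
  then show "g \<le> card (verts G)"
    using card_mono[of "verts G" "set xs"] G distinct_card[OF xs(1)] g
    by (simp add: simple_graph_def)
qed

text \<open>The induction needs \<open>u\<close> and \<open>n\<close> arbitrary, because a root
  \<open>v\<close> attached at \<open>w\<close> is traced back to the root \<open>w\<close> of the
  smaller graph. The equality case also records that the tip goes to the root, since only then can
  the map be extended by the next vertex.\<close>

lemma rooted_index_ge:
  assumes "pendant_ext (cycle_graph xs) G" "u \<in> verts G" "card (verts G) = n"
  shows "rooted_index (lollipop n g) (n - 1) \<le> rooted_index G u \<and>
    (rooted_index G u = rooted_index (lollipop n g) (n - 1) \<longrightarrow>
      (\<exists>f. inj_on f {..<n} \<and> map_graph f (lollipop n g) = G \<and> f (n - 1) = u))"
  using assms
proof (induction arbitrary: u n rule: pendant_ext.induct)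
  case base
  then have n: "n = g" and u: "u \<in> set xs"
    using distinct_card[OF xs(1)] g by (auto simp: cycle_graph_def)
  obtain f where f: "inj_on f {..<n}" "map_graph f (lollipop n g) = cycle_graph xs" "f (n - 1) = u"
    using cycle_graph_rooted_lollipop[OF xs u] n g by metis
  have "rooted_index (cycle_graph xs) u = rooted_index (lollipop n g) (n - 1)"
    using rooted_index_map_graph[of f "lollipop n g" "n - 1"] f simple_lollipop[of g n] n g xs
    by simp
  then show ?case using f by auto
next
  case (step G w v)
  define m where "m = card (verts G)"
  note G = pendant_ext_cycle_graph[OF step.hyps(1)]
  have m: "g \<le> m" "3 \<le> g" and n: "n = Suc m"
    using G g xs step.prems card_verts_add_pendant[OF G(1) step.hyps(3)] by (auto simp: m_def)
  note lol = rooted_index_lollipop_Suc[OF m(2,1)]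
  show ?case
  proof (cases "u = v")
    case True
    note IH = step.IH[OF step.hyps(2) m_def[symmetric]]
    have eq: "rooted_index (add_pendant w v G) u = Suc (rooted_index G w)"
      using rooted_index_new_pendant[OF G(1) step.hyps(2,3)] True by simp
    show ?thesis
    proof (intro conjI impI)
      show "rooted_index (lollipop n g) (n - 1) \<le> rooted_index (add_pendant w v G) u"
        using IH eq lol n by simp
      assume "rooted_index (add_pendant w v G) u = rooted_index (lollipop n g) (n - 1)"
      then have "rooted_index G w = rooted_index (lollipop m g) (m - 1)" using eq lol n by simp
      then obtain f where "inj_on f {..<m}" "map_graph f (lollipop m g) = G" "f (m - 1) = w"
        using IH by blast
      from map_graph_lollipop_Suc[OF m(2,1) this step.hyps(3)]
      show "\<exists>f. inj_on f {..<n} \<and> map_graph f (lollipop n g) = add_pendant w v G \<and> f (n - 1) = u"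
        using n True by (intro exI[of _ "f(m := v)"]) simp
    qed
  next
    \<comment> \<open>A root other than the new vertex gains at least two while the lollipop gains
      one, so equality is impossible here.\<close>
    case False
    then have u: "u \<in> verts G" using step.prems by (simp add: add_pendant_def)
    obtain T where T: "connected_graph T" "verts T = verts G" "edges T \<subseteq> edges G"
      "Suc (card (edges T)) = card (verts G)"
      using spanning_tree[OF G(1,2)] by blast
    \<comment> \<open>The tree has fewer edges than vertices, \<open>G\<close> equally many; so two
      distinct spanning subgraphs are available.\<close>
    have "T \<noteq> G" using T(4) G(3) by auto
    have "\<Union>(edges G) \<subseteq> verts G" using G(1) by (auto simp: simple_graph_def)
    then have "{G, T} \<subseteq> connected_subgraphs G"
      using T(1-3) G(2) unfolding connected_subgraphs_def connected_graph_def by (auto 0 4)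
    then have "rooted_index G u + card {G, T} \<le> rooted_index (add_pendant w v G) u"
      using rooted_index_add_pendant_ge[OF G(1) step.hyps(2,3) u] T(2) by blast
    then have "rooted_index G u + 2 \<le> rooted_index (add_pendant w v G) u"
      using \<open>T \<noteq> G\<close> by (simp add: eq_commute)
    then have "rooted_index (lollipop n g) (n - 1) < rooted_index (add_pendant w v G) u"
      using step.IH[OF u m_def[symmetric]] lol n by simp
    then show ?thesis by simp
  qed
qed

text \<open>Both terms of the recursion for \<open>core_index\<close> are bounded below by their
  values for the lollipop, so equality of the sums forces equality of the rooted terms; the map from
  \<open>rooted_index_ge\<close> then extends to the new vertex.\<close>

lemma core_index_ge:
  assumes "pendant_ext (cycle_graph xs) G" "card (verts G) = n"
  shows "core_index (lollipop n g) \<le> core_index G \<and>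
    (core_index G = core_index (lollipop n g) \<longrightarrow>
      (\<exists>f. inj_on f {..<n} \<and> map_graph f (lollipop n g) = G))"
  using assms
proof (induction arbitrary: n rule: pendant_ext.induct)
  case base
  then have n: "n = g" using distinct_card[OF xs(1)] g by (auto simp: cycle_graph_def)
  \<comment> \<open>Any vertex of the cycle would do as the root.\<close>
  have "last xs \<in> set xs" using xs by (intro last_in_set) auto
  then obtain f where f: "inj_on f {..<n}" "map_graph f (lollipop n g) = cycle_graph xs"
    using cycle_graph_rooted_lollipop[OF xs] n g by metis
  have "core_index (cycle_graph xs) = core_index (lollipop n g)"
    using core_index_map_graph[of f "lollipop n g"] f simple_lollipop[of g n] n g xs by simp
  then show ?case using f by auto
next
  case (step G w v)
  define m where "m = card (verts G)"
  note G = pendant_ext_cycle_graph[OF step.hyps(1)]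
  have m: "g \<le> m" "3 \<le> g" and n: "n = Suc m"
    using G g xs step.prems card_verts_add_pendant[OF G(1) step.hyps(3)] by (auto simp: m_def)
  note root = rooted_index_ge[OF step.hyps(1,2) m_def[symmetric]]
  note IH = step.IH[OF m_def[symmetric]]
  note lol = core_index_lollipop_Suc[OF m(2,1)]
  note eq = core_index_add_pendant[OF G(1) step.hyps(2,3)]
  show ?case
  proof (intro conjI impI)
    show "core_index (lollipop n g) \<le> core_index (add_pendant w v G)"
      using IH root lol eq n by simp
    assume "core_index (add_pendant w v G) = core_index (lollipop n g)"
    then have "rooted_index G w = rooted_index (lollipop m g) (m - 1)"
      using conjunct1[OF IH] conjunct1[OF root] lol eq n by simp
    then obtain f where "inj_on f {..<m}" "map_graph f (lollipop m g) = G" "f (m - 1) = w"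
      using root by blast
    from map_graph_lollipop_Suc[OF m(2,1) this step.hyps(3)]
    show "\<exists>f. inj_on f {..<n} \<and> map_graph f (lollipop n g) = add_pendant w v G"
      using n by blast
  qed
qed

end

section \<open>Counting in cycles and lollipops\<close>

context
  fixes g :: nat
  assumes g: "3 \<le> g"
begin

abbreviation (input) cyc :: "nat ugraph" where
  "cyc \<equiv> cycle_graph [0..<g]"

definition cyc_edge :: "nat \<Rightarrow> nat set" where
  "cyc_edge i = {i, Suc i mod g}"

text \<open>The path of \<open>k\<close> edges that starts at \<open>s\<close> and runs around the
  cycle in increasing direction. For \<open>s\<close> and \<open>k\<close> below \<open>g\<close>
  these turn out to be exactly the connected subgraphs other than the cycle itself.\<close>

definition arc :: "nat \<Rightarrow> nat \<Rightarrow> nat ugraph" where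
  "arc s k = ((\<lambda>i. (s + i) mod g) ` {..k}, (\<lambda>i. cyc_edge ((s + i) mod g)) ` {..<k})"

lemma cyc_eq: "cyc = ({..<g}, cyc_edge ` {..<g})"
proof -
  have "[0..<g] ! (Suc i mod g) = Suc i mod g" for i
    using g mod_less_divisor[of g "Suc i"] by simp
  then show ?thesis
    by (auto simp: cycle_graph_def cycle_edges_image cyc_edge_def atLeast0LessThan intro!: image_cong)
qed

lemma inj_on_cyc_edge: "inj_on cyc_edge {..<g}"
  using g by (auto simp: inj_on_def cyc_edge_def Suc_mod_eq doubleton_eq_iff split: if_splits)

lemma cyc_edge_shift: "cyc_edge ((s + i) mod g) = {(s + i) mod g, (s + Suc i) mod g}"
  by (simp add: cyc_edge_def mod_simps)

lemma inj_on_shift: "inj_on (\<lambda>i. (s + i) mod g) {..<g}"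
proof (rule linorder_inj_onI)
  fix i j :: nat assume ij: "i < j" "i \<in> {..<g}" "j \<in> {..<g}"
  show "(s + i) mod g \<noteq> (s + j) mod g"
  proof
    assume "(s + i) mod g = (s + j) mod g"
    then have "g dvd (s + j) - (s + i)" using ij
      by (metis mod_eq_dvd_iff_nat add_le_cancel_left less_imp_le)
    then show False using ij by (auto dest: dvd_imp_le)
  qed
qed auto

text \<open>The number of edges recovers \<open>k\<close> from an arc and tells arcs with
  \<open>k < g\<close> from the whole cycle.\<close>

lemma card_edges_arc:
  assumes "k \<le> g"
  shows "card (edges (arc s k)) = k"
proof -
  have "inj_on (\<lambda>i. cyc_edge ((s + i) mod g)) {..<g}"
    using comp_inj_on[OF inj_on_shift inj_on_subset[OF inj_on_cyc_edge], of s] g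
    by (auto simp: comp_def image_subset_iff)
  then have "inj_on (\<lambda>i. cyc_edge ((s + i) mod g)) {..<k}"
    by (rule inj_on_subset) (use assms in auto)
  then show ?thesis by (simp add: arc_def card_image)
qed

lemma arc_in_connected_subgraphs: "arc s k \<in> connected_subgraphs cyc"
proof -
  have "(s mod g, (s + i) mod g) \<in> (adj (edges (arc s k)))\<^sup>*" if "i \<le> k" for i
    using that
  proof (induction i)
    case (Suc i)
    then have "cyc_edge ((s + i) mod g) \<in> edges (arc s k)" by (auto simp: arc_def)
    then have "((s + i) mod g, (s + Suc i) mod g) \<in> adj (edges (arc s k))"
      unfolding cyc_edge_shift by simp
    then show ?case using Suc by (auto intro: rtrancl_into_rtrancl)
  qed auto
  moreover have "s mod g \<in> verts (arc s k)" by (force simp: arc_def)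
  ultimately have "connected_graph (verts (arc s k), edges (arc s k))"
    by (intro connected_graphI_root[of "s mod g"]) (auto simp: arc_def)
  moreover have "\<Union>(edges (arc s k)) \<subseteq> verts (arc s k)"
  proof -
    have "cyc_edge ((s + i) mod g) \<subseteq> (\<lambda>i. (s + i) mod g) ` {..k}" if "i < k" for i
      unfolding cyc_edge_shift using that by (auto intro!: imageI simp del: add_Suc_right)
    then show ?thesis by (auto simp: arc_def)
  qed
  moreover have "verts (arc s k) \<subseteq> {..<g}" "edges (arc s k) \<subseteq> cyc_edge ` {..<g}"
    using g by (auto simp: arc_def)
  ultimately show ?thesis
    using connected_subgraphs_iff[of "verts (arc s k)" "edges (arc s k)"] by (simp add: cyc_eq)
qed

text \<open>The start \<open>s\<close> is a vertex of \<open>V\<close> whose preceding edge is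
  absent, and \<open>k\<close> counts the edges present from \<open>s\<close> up to the next absent
  one. The vertices met form a set closed under adjacency in \<open>E\<close>, hence contain all of
  \<open>V\<close>.\<close>

lemma proper_connected_subgraph_is_arc:
  assumes H: "(V, E) \<in> connected_subgraphs cyc" and proper: "(V, E) \<noteq> cyc"
  obtains s k where "s < g" "k < g" "(V, E) = arc s k"
proof -
  have V: "V \<subseteq> {..<g}" and E: "E \<subseteq> cyc_edge ` {..<g}" and sub: "\<Union>E \<subseteq> V"
    and conn: "connected_graph (V, E)"
    using H by (auto simp: cyc_eq connected_subgraphs_iff)
  have "\<exists>p<g. Suc p mod g \<in> V \<and> cyc_edge p \<notin> E"
  proof (rule ccontr)
    assume no: "\<not> ?thesis"
    \<comment> \<open>Without such an edge, \<open>V\<close> is closed under predecessors, hence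
      contains every vertex, and then all edges are present.\<close>
    have pred: "p \<in> V" if "p < g" "Suc p mod g \<in> V" for p
      using no that sub by (auto simp: cyc_edge_def)
    have down: "j \<in> V" if "s \<in> V" "j \<le> s" for j s
      using that(2,1)
    proof (induction j rule: inc_induct)
      case (step j)
      then show ?case using V pred[of j] by auto
    qed
    obtain r where "r \<in> V" using conn by (auto simp: connected_graph_def)
    then have "0 \<in> V" using down by blast
    then have "g - 1 \<in> V" using pred[of "g - 1"] g by simp
    then have "V = {..<g}" using down V by fastforce
    moreover from this have "E = cyc_edge ` {..<g}" using no E g by auto
    ultimately show False using proper by (simp add: cyc_eq)
  qed
  then obtain p where p: "p < g" "Suc p mod g \<in> V" "cyc_edge p \<notin> E" by blast
  define s where "s = Suc p mod g"
  have s: "s < g" "s \<in> V" using g p by (simp_all add: s_def)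
  have "(s + (g - 1)) mod g = (Suc p + (g - 1)) mod g" by (simp add: s_def mod_simps)
  also have "Suc p + (g - 1) = p + g" using g by simp
  finally have last: "(s + (g - 1)) mod g = p" using p by simp
  \<comment> \<open>The minimum exists and is at most \<open>g - 1\<close>, because
    \<open>g - 1\<close> steps from \<open>s\<close> lead to \<open>p\<close>, whose outgoing edge
    is absent.\<close>
  define k where "k = (LEAST k. cyc_edge ((s + k) mod g) \<notin> E)"
  have k: "k \<le> g - 1" "cyc_edge ((s + k) mod g) \<notin> E"
    unfolding k_def using last p(3)
      Least_le[of "\<lambda>k. cyc_edge ((s + k) mod g) \<notin> E" "g - 1"]
      LeastI[of "\<lambda>k. cyc_edge ((s + k) mod g) \<notin> E" "g - 1"] by blast+
  have ltk: "cyc_edge ((s + i) mod g) \<in> E" if "i < k" for i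
    using not_less_Least[of i "\<lambda>k. cyc_edge ((s + k) mod g) \<notin> E"] that by (simp add: k_def)
  define A where "A = (\<lambda>i. (s + i) mod g) ` {..k}"
  \<comment> \<open>An edge present at position \<open>i\<close> cannot be the absent one at
    \<open>k\<close>, so the next vertex still belongs to \<open>A\<close>.\<close>
  have succ: "(s + Suc i) mod g \<in> A \<and> i < k"
    if "i \<le> k" "cyc_edge ((s + i) mod g) \<in> E" for i
    using that k(2) by (cases "i = k") (auto simp: A_def simp del: add_Suc_right)
  have "V \<subseteq> A"
  proof (rule connected_graph_closed_subset[OF conn])
    show "s \<in> A" using s by (force simp: A_def)
    show "s \<in> V" by fact
    fix x y assume "x \<in> A" and xy: "{x, y} \<in> E"
    then obtain i where i: "i \<le> k" "x = (s + i) mod g" by (auto simp: A_def)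
    obtain j where j: "j < g" "{x, y} = cyc_edge j" using xy E by auto
    then consider "x = j" "y = Suc j mod g" | "y = j" "x = Suc j mod g"
      by (auto simp: cyc_edge_def doubleton_eq_iff)
    then show "y \<in> A"
    proof cases
      case 1
      then have "cyc_edge ((s + i) mod g) \<in> E" using xy i j by simp
      moreover have "y = (s + Suc i) mod g" using 1 i by (metis add_Suc_right mod_Suc_eq)
      ultimately show ?thesis using succ[OF i(1)] by simp
    next
      case 2
      show ?thesis
      proof (cases i)
        \<comment> \<open>Stepping back from \<open>s\<close> would use the absent edge at
          \<open>p\<close>.\<close>
        case 0
        then have "Suc j mod g = Suc p mod g" using 2 i s by (simp add: s_def)
        then have "j = p" using j(1) p(1) by (auto simp: Suc_mod_eq split: if_splits)
        then show ?thesis using xy j p by simp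
      next
        case (Suc i')
        have "Suc ((s + i') mod g) mod g = Suc j mod g" using 2 i Suc by (simp add: mod_simps)
        moreover have "(s + i') mod g < g" using g by simp
        ultimately have "j = (s + i') mod g"
          using j(1) by (auto simp: Suc_mod_eq split: if_splits)
        then show ?thesis using 2 Suc i by (auto simp: A_def)
      qed
    qed
  qed
  moreover have "A \<subseteq> V"
  proof
    fix x assume "x \<in> A"
    then obtain i where i: "i \<le> k" "x = (s + i) mod g" by (auto simp: A_def)
    show "x \<in> V"
    proof (cases i)
      case 0
      then show ?thesis using i s by simp
    next
      case (Suc i')
      then have "cyc_edge ((s + i') mod g) \<subseteq> V" using ltk[of i'] i sub by auto
      then show ?thesis using i Suc unfolding cyc_edge_shift by simp
    qed
  qed
  ultimately have VA: "V = A" by blast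
  have "E \<subseteq> (\<lambda>i. cyc_edge ((s + i) mod g)) ` {..<k}"
  proof
    fix e assume e: "e \<in> E"
    then obtain j where j: "j < g" "e = cyc_edge j" using E by auto
    then have "j \<in> A" using e sub VA by (auto simp: cyc_edge_def)
    then obtain i where "i \<le> k" "j = (s + i) mod g" by (auto simp: A_def)
    then show "e \<in> (\<lambda>i. cyc_edge ((s + i) mod g)) ` {..<k}" using succ[of i] e j by auto
  qed
  then have "(V, E) = arc s k" using VA ltk by (auto simp: arc_def A_def)
  moreover have "k < g" using k(1) g by linarith
  ultimately show ?thesis using that s(1) by blast
qed

text \<open>Equal numbers of edges give \<open>k = k'\<close>. If \<open>s'\<close> lay further
  along the arc from \<open>s\<close>, the edge entering \<open>s'\<close> would also be found
  \<open>j < k\<close> steps after \<open>s'\<close>, which makes \<open>g\<close> divide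
  \<open>Suc j < g\<close>.\<close>

lemma inj_on_arc: "inj_on (\<lambda>(s, k). arc s k) ({..<g} \<times> {..<g})"
proof (rule inj_onI, clarsimp)
  fix s k s' k' assume lt: "s < g" "k < g" "s' < g" "k' < g" and eq: "arc s k = arc s' k'"
  have k: "k = k'" using eq card_edges_arc[of k s] card_edges_arc[of k' s'] lt by simp
  have "s' mod g \<in> verts (arc s' k')" by (force simp: arc_def)
  then have "s' \<in> verts (arc s k)" using eq lt by simp
  then obtain i where i: "i \<le> k" "s' = (s + i) mod g" by (auto simp: arc_def)
  have "i = 0"
  proof (cases i)
    case (Suc i')
    then have "cyc_edge ((s + i') mod g) \<in> edges (arc s' k')"
      unfolding eq[symmetric] using i by (auto simp: arc_def)
    then obtain j where j: "j < k" "cyc_edge ((s + i') mod g) = cyc_edge ((s' + j) mod g)"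
      using k by (auto simp: arc_def)
    then have "(s + i') mod g = (s' + j) mod g"
      using inj_on_cyc_edge lt(1) by (auto simp: inj_on_def)
    then have "(s + i') mod g = (s + i' + Suc j) mod g" using i Suc by (simp add: mod_simps)
    then have "g dvd Suc j" by (metis add_diff_cancel_left' le_add1 mod_eq_dvd_iff_nat)
    then show ?thesis using j lt by (auto dest: dvd_imp_le)
  qed
  then show "s = s' \<and> k = k'" using i lt k by simp
qed

lemma connected_subgraphs_cycle:
  "connected_subgraphs cyc = insert cyc ((\<lambda>(s, k). arc s k) ` ({..<g} \<times> {..<g}))"
proof (intro equalityI subsetI)
  fix H assume H: "H \<in> connected_subgraphs cyc"
  show "H \<in> insert cyc ((\<lambda>(s, k). arc s k) ` ({..<g} \<times> {..<g}))"
  proof (cases "H = cyc")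
    case False
    then obtain s k where "s < g" "k < g" "H = arc s k"
      using proper_connected_subgraph_is_arc[of "verts H" "edges H"] H by (metis prod.collapse)
    then show ?thesis by auto
  qed simp
next
  have "cyc \<in> connected_subgraphs cyc"
    using unicyclic_cycle_graph[of "[0..<g]"] g
    by (auto simp: connected_subgraphs_def unicyclic_def simple_graph_def connected_graph_def)
  then show "H \<in> connected_subgraphs cyc"
    if "H \<in> insert cyc ((\<lambda>(s, k). arc s k) ` ({..<g} \<times> {..<g}))" for H
    using that arc_in_connected_subgraphs by auto
qed

lemma cycle_neq_arc: "k < g \<Longrightarrow> cyc \<noteq> arc s k"
proof
  assume "k < g" "cyc = arc s k"
  then have "cyc_edge ` {..<g} = edges (arc s k)" unfolding cyc_eq by (metis snd_conv)
  then have "card (cyc_edge ` {..<g}) = k" using card_edges_arc[of k s] \<open>k < g\<close> by simp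
  then show False using \<open>k < g\<close> by (simp add: card_image inj_on_cyc_edge)
qed

text \<open>There is one arc for each of the \<open>g\<close> starts and \<open>g\<close> lengths,
  and the cycle itself.\<close>

lemma core_index_cycle: "core_index cyc = g\<^sup>2 + 1"
proof -
  have "cyc \<notin> (\<lambda>(s, k). arc s k) ` ({..<g} \<times> {..<g})" using cycle_neq_arc by auto
  then show ?thesis
    by (simp add: core_index_def connected_subgraphs_cycle card_image[OF inj_on_arc]
        power2_eq_square)
qed

text \<open>From \<open>s\<close> the vertex \<open>g - 1\<close> is first met after
  \<open>g - 1 - s\<close> steps, before any wrap-around.\<close>

lemma last_in_arc_iff:
  assumes "s < g" "k < g"
  shows "g - 1 \<in> verts (arc s k) \<longleftrightarrow> g - 1 \<le> s + k"
proof
  assume "g - 1 \<in> verts (arc s k)"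
  then obtain i where i: "i \<le> k" "(s + i) mod g = g - 1" by (auto simp: arc_def)
  then have "g - 1 \<le> s + i" using mod_less_eq_dividend[of "s + i" g] by simp
  then show "g - 1 \<le> s + k" using i by simp
next
  assume "g - 1 \<le> s + k"
  then have "g - 1 - s \<le> k" "(s + (g - 1 - s)) mod g = g - 1" using assms by auto
  then show "g - 1 \<in> verts (arc s k)" by (force simp: arc_def)
qed

text \<open>For each start \<open>s\<close> exactly \<open>s + 1\<close> lengths reach the root.
  These sum to half of \<open>g * (g + 1)\<close>, and the whole cycle adds one; doubling avoids the
  division.\<close>

lemma rooted_index_cycle: "2 * rooted_index cyc (g - 1) = g * (g + 1) + 2"
proof -
  let ?S = "SIGMA s:{..<g}. {g - 1 - s..<g}"
  have "{H \<in> connected_subgraphs cyc. g - 1 \<in> verts H} = insert cyc ((\<lambda>(s, k). arc s k) ` ?S)"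
  proof -
    have "g - 1 \<in> verts cyc" using g by (simp add: cycle_graph_def)
    moreover have "?S = {x \<in> {..<g} \<times> {..<g}. g - 1 \<in> verts ((\<lambda>(s, k). arc s k) x)}"
      using last_in_arc_iff by auto
    ultimately show ?thesis unfolding connected_subgraphs_cycle by blast
  qed
  moreover have "cyc \<notin> (\<lambda>(s, k). arc s k) ` ?S" by (auto dest: cycle_neq_arc)
  moreover have "card ((\<lambda>(s, k). arc s k) ` ?S) = card ?S"
    by (intro card_image inj_on_subset[OF inj_on_arc]) auto
  ultimately have "rooted_index cyc (g - 1) = Suc (card ?S)"
    by (simp add: rooted_index_def)
  moreover have "card ?S = (\<Sum>s<g. g - (g - 1 - s))" by simp
  moreover have "\<dots> = (\<Sum>s<g. Suc s)" by (intro sum.cong) auto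
  moreover have "2 * (\<Sum>s<m. Suc s) = m * (m + 1)" for m by (induction m) auto
  ultimately show ?thesis by simp
qed

end

section \<open>Closed forms for the lollipop\<close>

lemma rooted_index_lollipop:
  assumes "3 \<le> g" "g \<le> n"
  shows "2 * rooted_index (lollipop n g) (n - 1) = g * (g + 1) + 2 + 2 * (n - g)"
  using assms(2)
proof (induction n rule: dec_induct)
  case base
  show ?case using assms rooted_index_cycle[of g] by (simp add: lollipop_self)
next
  case (step n)
  then show ?case using rooted_index_lollipop_Suc[OF assms(1) step.hyps(1)] by simp
qed

text \<open>Each tail vertex adds one plus the rooted index at the old tip, which is linear in the
  length of the tail; an arithmetic progression is summed on top of the value for the cycle.\<close>

lemma core_index_lollipop:
  assumes "3 \<le> g" "g \<le> n"
  shows "real (core_index (lollipop n g)) =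
    ((real n - real g) / 2) * (real n + (real g)\<^sup>2 + 3) + (real g)\<^sup>2 + 1"
  using assms(2)
proof (induction n rule: dec_induct)
  case base
  show ?case using assms core_index_cycle[of g] by (simp add: lollipop_self)
next
  case (step n)
  \<comment> \<open>The doubled count is transferred to the reals, where \<open>n - g\<close> may be
    expanded because \<open>g \<le> n\<close>.\<close>
  have "real (2 * rooted_index (lollipop n g) (n - 1)) = real (g * (g + 1) + 2 + 2 * (n - g))"
    using rooted_index_lollipop[OF assms(1) step.hyps(1)] by (rule arg_cong)
  then have "2 * real (rooted_index (lollipop n g) (n - 1)) =
      real g * (real g + 1) + 2 + 2 * (real n - real g)"
    using step.hyps by (simp add: of_nat_diff algebra_simps)
  moreover have "real (core_index (lollipop (Suc n) g)) =
      real (core_index (lollipop n g)) + 1 + real (rooted_index (lollipop n g) (n - 1))"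
    using core_index_lollipop_Suc[OF assms(1) step.hyps(1)] by simp
  ultimately show ?case
    using step.IH by (simp add: field_simps power2_eq_square)
qed

theorem theorem4p8:
  fixes n g :: nat
  assumes "3 \<le> g" and "g < n"
  shows "(\<forall>G :: 'a ugraph. unicyclic G \<and> card (verts G) = n \<and> girth G = g \<longrightarrow>
            core_index (lollipop n g) \<le> core_index G \<and>
            (core_index G = core_index (lollipop n g) \<longleftrightarrow> graph_iso G (lollipop n g))) \<and>
         real (core_index (lollipop n g)) =
           ((real n - real g) / 2) * (real n + (real g)\<^sup>2 + 3) + (real g)\<^sup>2 + 1"
proof (intro conjI allI impI)
  show "real (core_index (lollipop n g)) =
      ((real n - real g) / 2) * (real n + (real g)\<^sup>2 + 3) + (real g)\<^sup>2 + 1"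
    using core_index_lollipop assms by simp
  have lol: "simple_graph (lollipop n g)" using simple_lollipop assms by simp
  fix G :: "'a ugraph"
  assume "unicyclic G \<and> card (verts G) = n \<and> girth G = g"
  then have G: "unicyclic G" "card (verts G) = n" "girth G = g" by auto
  obtain xs where xs: "distinct xs" "3 \<le> length xs" "length xs = g"
    "pendant_ext (cycle_graph xs) G"
    using unicyclic_girth[OF G(1)] G(3) by metis
  note bound = core_index_ge[OF xs(1,2) xs(3)[symmetric] xs(4) G(2)]
  show "core_index (lollipop n g) \<le> core_index G" using bound by blast
  show "core_index G = core_index (lollipop n g) \<longleftrightarrow> graph_iso G (lollipop n g)"
  proof
    assume "core_index G = core_index (lollipop n g)"
    then obtain f where "inj_on f {..<n}" "map_graph f (lollipop n g) = G" using bound by blast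
    then show "graph_iso G (lollipop n g)" using graph_iso_map_graph[OF _ lol, of f] by simp
  next
    assume "graph_iso G (lollipop n g)"
    then show "core_index G = core_index (lollipop n g)"
      using graph_iso_core_index[OF _ _ lol, of G] G(1) by (simp add: unicyclic_def)
  qed
qed

end
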